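(* Let $\alpha>0$ and $n\ge 3$. Let $\mathbf m=(m_1,\dots,m_n)$ be a vector of positive masses such that all masses are equal except for two; that is, there are a real number $\mu>0$ and two distinct indices $j,k\in\{1,\dots,n\}$ such that $m_i=\mu$ for all $i\notin\{j,k\}$, while $m_j\neq\mu$ and $m_k\neq\mu$ (the case $m_j=m_k$ is allowed). Then there is no centered co-circular central configuration, for the power-law potential with exponent $\alpha$, with masses $\mathbf m$.
   Context: Power-law $n$-body problem with exponent $\alpha>0$: the potential is $U_\alpha=\sum_{i<j}\frac{m_im_j}{|q_i-q_j|^\alpha}$, for positive masses $m_1,\dots,m_n$ at distinct points $q_1,\dots,q_n$ of the plane $\mathbb C$. Centered co-circular central configuration with masses $\mathbf m=(m_1,\dots,m_n)$: the masses are placed at distinct points of the unit circle centered at the origin, $q_j=e^{\sqrt{-1}\,\theta_j}$ with $0<\theta_1<\theta_2<\cdots<\theta_n\le 2\pi$ (so the order of the entries of $\mathbf m$ is the cyclic order of the masses on the circle), and there is a real number $\lambda$ such that $$\sum_{j\ne k}\frac{m_j(q_j-q_k)}{r_{jk}^{\alpha+2}}+\frac{\lambda}{\alpha}\,q_k=0\qquad\text{for all }k\in\{1,\dots,n\},$$ where $r_{jk}=|q_j-q_k|$. (This is a central configuration lying on a circle whose center of mass is the center of that circle.) *)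

theory Defs
  imports Complex_Main
begin

text \<open>Bodies are indexed by \<open>{1..n}\<close>; the values of \<open>m\<close>, \<open>q\<close> and \<open>\<theta>\<close> outside this range are
  irrelevant.  The plane is the type of complex numbers.\<close>

definition central_eqs :: "real \<Rightarrow> nat \<Rightarrow> (nat \<Rightarrow> real) \<Rightarrow> (nat \<Rightarrow> complex) \<Rightarrow> real \<Rightarrow> bool" where
  "central_eqs \<alpha> n m q l \<longleftrightarrow>
     (\<forall>k\<in>{1..n}.
        (\<Sum>j\<in>{1..n} - {k}. (m j / cmod (q j - q k) powr (\<alpha> + 2)) *\<^sub>R (q j - q k))
          + (l / \<alpha>) *\<^sub>R q k = 0)"

text \<open>Strict monotonicity of the angles makes the positions distinct and makes the order of the
  entries of \<open>m\<close> the cyclic order of the masses on the circle.  That the center of mass is the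
  center of the circle is not imposed separately: for positive masses and \<open>n \<ge> 2\<close>
  it follows from the equations.  Their sum weighted with the masses says that \<open>l\<close> times the center of
  mass vanishes, and \<open>l > 0\<close> by taking the inner product of an equation with \<open>q k\<close>.\<close>

definition centered_cocircular_cc ::
    "real \<Rightarrow> nat \<Rightarrow> (nat \<Rightarrow> real) \<Rightarrow> (nat \<Rightarrow> complex) \<Rightarrow> bool" where
  "centered_cocircular_cc \<alpha> n m q \<longleftrightarrow>
     (\<exists>\<theta> :: nat \<Rightarrow> real.
        strict_mono_on {1..n} \<theta> \<and> 0 < \<theta> 1 \<and> \<theta> n \<le> 2 * pi \<and> (\<forall>j\<in>{1..n}. q j = cis (\<theta> j))) \<and>
     (\<exists>l :: real. central_eqs \<alpha> n m q l)"

end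

theory Submission
  imports Defs "HOL-Analysis.Convex"
begin

text \<open>Let \<open>W\<close> be the symmetric matrix with entries \<open>r\<^sub>i\<^sub>j\<close> to the power \<open>- \<alpha>\<close> and zero diagonal.  The radial
  components of the central configuration equations say that \<open>W m\<close> is a constant vector, the
  tangential ones that the angles are a critical point of the potential, hence, by convexity, a
  minimum for the given cyclic order.  A reflection of the cyclic order turns \<open>m\<close> into \<open>m'\<close> without
  changing the minimum, so \<open>\<delta> = m' - m\<close> satisfies \<open>\<delta>\<^sup>T W \<delta> \<ge> 0\<close>.  This fails
  if \<open>\<delta>\<close> is supported on two points, which happens for the reflection fixing \<open>j\<close> unless \<open>k\<close> is opposite to
  \<open>j\<close>, and for the one exchanging \<open>j\<close> and \<open>k\<close> unless \<open>m j = m k\<close>.  In the remaining case the reflection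
  exchanging \<open>j\<close> with \<open>j + 1\<close> and \<open>k\<close> with \<open>k + 1\<close> gives a multiple of the difference between the
  diagonals and the sides of a quadrilateral, which is negative.\<close>

section \<open>Pair potential and tangential force on the unit circle\<close>

definition circle_pot :: "real \<Rightarrow> real \<Rightarrow> real" where
  "circle_pot \<alpha> t = \<bar>2 * sin (t / 2)\<bar> powr (- \<alpha>)"

text \<open>Up to the factor \<open>- \<alpha>\<close>, this is the derivative of
  \<open>circle_pot \<alpha>\<close> on (0, 2 pi). The base of the power is the chord length
  subtended by the angle \<open>t\<close>.\<close>

definition circle_force :: "real \<Rightarrow> real \<Rightarrow> real" where
  "circle_force \<alpha> t = sin t / \<bar>2 * sin (t / 2)\<bar> powr (\<alpha> + 2)"

lemma circle_pot_minus [simp]: "circle_pot \<alpha> (- t) = circle_pot \<alpha> t"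
  by (simp add: circle_pot_def)

lemma circle_pot_commute: "circle_pot \<alpha> (x - y) = circle_pot \<alpha> (y - x)"
  using circle_pot_minus[of \<alpha> "x - y"] by simp

text \<open>By \<open>0 powr x = 0\<close>, so double sums over the bodies may include the diagonal.\<close>

lemma circle_pot_0 [simp]: "circle_pot \<alpha> 0 = 0"
  by (simp add: circle_pot_def)

lemma circle_force_minus [simp]: "circle_force \<alpha> (- t) = - circle_force \<alpha> t"
  by (simp add: circle_force_def)

lemma circle_force_0 [simp]: "circle_force \<alpha> 0 = 0"
  by (simp add: circle_force_def)

lemma circle_pot_shift: "circle_pot \<alpha> (2 * pi - t) = circle_pot \<alpha> t"
proof -
  have "sin ((2 * pi - t) / 2) = sin (t / 2)"
    by (simp add: diff_divide_distrib)
  then show ?thesis by (simp add: circle_pot_def)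
qed

lemma cos_sin_half: "cos x = 1 - 2 * (sin (x / 2))\<^sup>2" for x :: real
  using cos_double_sin[of "x / 2"] by simp

lemma cmod_cis_diff: "cmod (cis a - cis b) = \<bar>2 * sin ((a - b) / 2)\<bar>"
proof -
  have "(cmod (cis a - cis b))\<^sup>2 = 2 - 2 * cos (a - b)"
    using arg_cong2[where f = "(+)", OF sin_cos_squared_add[of a] sin_cos_squared_add[of b]]
    by (simp add: cmod_power2 cos_diff power2_diff del: sin_cos_squared_add sin_cos_squared_add2)
  also have "\<dots> = \<bar>2 * sin ((a - b) / 2)\<bar>\<^sup>2"
    by (simp add: cos_sin_half[of "a - b"] power_mult_distrib)
  finally show ?thesis by (simp only: power2_eq_iff_nonneg norm_ge_zero abs_ge_zero)
qed

text \<open>Convexity on (0, 2 pi): both terms of the second derivative are nonnegative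
  there.\<close>

lemma circle_pot_above_tangent:
  assumes "\<alpha> > 0" "x \<in> {0<..<2*pi}" "y \<in> {0<..<2*pi}"
  shows "circle_pot \<alpha> y \<ge> circle_pot \<alpha> x - \<alpha> * circle_force \<alpha> x * (y - x)"
proof -
  define C where "C = {0<..<2*pi::real}"
  define f where "f t = (2 * sin (t/2)) powr (-\<alpha>)" for t :: real
  define f' where "f' t = - \<alpha> * cos (t/2) * (2 * sin (t/2)) powr (-\<alpha>-1)" for t :: real
  define f'' where "f'' t = \<alpha> / 2 * sin (t/2) * (2 * sin (t/2)) powr (-\<alpha>-1)
    + \<alpha> * (\<alpha>+1) * (cos (t/2))\<^sup>2 * (2 * sin (t/2)) powr (-\<alpha>-2)" for t :: real
  have pos: "sin (t/2) > 0" if "t \<in> C" for t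
    using that by (auto simp: C_def intro!: sin_gt_zero)
  have d1: "(f has_real_derivative f' t) (at t)" if "t \<in> C" for t
  proof -
    have "(f has_real_derivative (- \<alpha>) * (2 * sin (t/2)) powr (- \<alpha> - of_nat 1) * cos (t/2)) (at t)"
      unfolding f_def using pos[OF that] by (intro DERIV_fun_powr) (auto intro!: derivative_eq_intros)
    then show ?thesis by (simp add: f'_def mult_ac)
  qed
  have d2: "(f' has_real_derivative f'' t) (at t)" if "t \<in> C" for t
  proof -
    have "((\<lambda>t. (2 * sin (t/2)) powr (- \<alpha> - 1)) has_real_derivative
        (- \<alpha> - 1) * (2 * sin (t/2)) powr (- \<alpha> - 1 - of_nat 1) * cos (t/2)) (at t)"
      using pos[OF that] by (intro DERIV_fun_powr) (auto intro!: derivative_eq_intros)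
    moreover have "((\<lambda>t. - \<alpha> * cos (t/2)) has_real_derivative \<alpha> / 2 * sin (t/2)) (at t)"
      by (auto intro!: derivative_eq_intros)
    ultimately show ?thesis unfolding f'_def f''_def
      by (rule DERIV_cong[OF DERIV_mult[rotated]]) (simp add: algebra_simps power2_eq_square)
  qed
  have nn: "f'' t \<ge> 0" if "t \<in> C" for t
    unfolding f''_def using pos[OF that] \<open>\<alpha> > 0\<close> by simp
  have "f' x * (y - x) \<le> f y - f x"
    by (rule f''_imp_f'[where C = C]) (use d1 d2 nn assms in \<open>auto simp: C_def\<close>)
  moreover have "f' x = - \<alpha> * circle_force \<alpha> x"
  proof -
    have "sin x = 2 * sin (x/2) * cos (x/2)" using sin_double[of "x/2"] by simp
    moreover have "(2 * sin (x/2)) powr (- \<alpha> - 1) = (2 * sin (x/2)) / (2 * sin (x/2)) powr (\<alpha> + 2)"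
      using pos[of x] assms powr_add[of "2 * sin (x/2)" "- \<alpha> - 1" "\<alpha> + 2"] 
      by (simp add: C_def field_simps)
    ultimately show ?thesis
      using pos[of x] assms by (simp add: f'_def circle_force_def C_def)
  qed
  moreover have "circle_pot \<alpha> t = f t" if "t \<in> C" for t
    using pos[OF that] by (simp add: f_def circle_pot_def)
  ultimately show ?thesis using assms by (simp add: C_def algebra_simps)
qed

lemma circle_pot_le:
  assumes "\<alpha> > 0" "0 < u" "u \<le> v" "v \<le> pi"
  shows "circle_pot \<alpha> v \<le> circle_pot \<alpha> u"
proof -
  have "sin (u/2) \<le> sin (v/2)"
    using assms by (intro sin_monotone_2pi_le) auto
  moreover have "sin (u/2) > 0" using assms by (intro sin_gt_zero) auto
  ultimately show ?thesis
    unfolding circle_pot_def using assms by (intro powr_mono2') auto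
qed

lemma circle_pot_pos: "0 < t \<Longrightarrow> t < 2 * pi \<Longrightarrow> circle_pot \<alpha> t > 0"
  using sin_gt_zero[of "t / 2"] by (simp add: circle_pot_def)

text \<open>Each diagonal is at least as long as the two sides on one side of it.\<close>

lemma circle_pot_diagonals_less_sides:
  assumes "\<alpha> > 0" "a < b" "b < c" "c < d" "d < a + 2 * pi"
  shows "circle_pot \<alpha> (c - a) + circle_pot \<alpha> (d - b)
    < circle_pot \<alpha> (b - a) + circle_pot \<alpha> (c - b) + circle_pot \<alpha> (d - c) + circle_pot \<alpha> (d - a)"
proof -
  let ?g = "circle_pot \<alpha>"
  have pos: "?g (b - a) > 0" "?g (c - b) > 0" "?g (d - c) > 0" "?g (d - a) > 0"
    using assms by (auto intro!: circle_pot_pos)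
  have da: "?g (2 * pi - (d - a)) = ?g (d - a)" by (rule circle_pot_shift)
  have "?g (c - a) \<le> ?g (b - a) \<and> ?g (c - a) \<le> ?g (c - b) \<or>
        ?g (c - a) \<le> ?g (d - c) \<and> ?g (c - a) \<le> ?g (d - a)"
  proof (cases "c - a \<le> pi")
    case True
    then show ?thesis using assms by (auto intro!: circle_pot_le)
  next
    case False
    \<comment> \<open>The complementary arc, through \<open>d\<close>, is now shorter than a half
      circle and contains the sides from \<open>c\<close> to \<open>d\<close> and from
      \<open>d\<close> to \<open>a\<close>.\<close>
    then have "?g (2 * pi - (c - a)) \<le> ?g (d - c)" "?g (2 * pi - (c - a)) \<le> ?g (2 * pi - (d - a))"
      using assms by (auto intro!: circle_pot_le)
    then show ?thesis unfolding circle_pot_shift by blast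
  qed
  moreover have "?g (d - b) \<le> ?g (c - b) \<and> ?g (d - b) \<le> ?g (d - c) \<or>
        ?g (d - b) \<le> ?g (b - a) \<and> ?g (d - b) \<le> ?g (d - a)"
  proof (cases "d - b \<le> pi")
    case True
    then show ?thesis using assms by (auto intro!: circle_pot_le)
  next
    case False
    then have "?g (2 * pi - (d - b)) \<le> ?g (b - a)" "?g (2 * pi - (d - b)) \<le> ?g (2 * pi - (d - a))"
      using assms by (auto intro!: circle_pot_le)
    then show ?thesis unfolding circle_pot_shift by blast
  qed
  \<comment> \<open>In every case the two diagonals can be bounded by two different sides; the
    remaining two sides give strictness.\<close>
  ultimately show ?thesis using pos by linarith
qed

text \<open>Multiplying the equation at \<open>k\<close> by \<open>cis (- \<theta> k)\<close>
  rotates \<open>q k\<close> to 1; the real part then gives the potential and the imaginary part the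
  force.\<close>

lemma central_eqs_cis:
  assumes "central_eqs \<alpha> n m q l" "\<forall>j\<in>{1..n}. q j = cis (\<theta> j)" "k \<in> {1..n}"
  shows "(\<Sum>j\<in>{1..n}. m j * circle_pot \<alpha> (\<theta> j - \<theta> k)) = 2 * l / \<alpha>"
    and "(\<Sum>j\<in>{1..n}. m j * circle_force \<alpha> (\<theta> j - \<theta> k)) = 0"
proof -
  let ?r = "\<lambda>j. \<bar>2 * sin ((\<theta> j - \<theta> k) / 2)\<bar>"
  have "(\<Sum>j\<in>{1..n} - {k}. (m j / cmod (q j - q k) powr (\<alpha> + 2)) *\<^sub>R (q j - q k)) + (l / \<alpha>) *\<^sub>R q k = 0"
    using assms by (simp add: central_eqs_def)
  moreover have "(\<Sum>j\<in>{1..n} - {k}. (m j / cmod (q j - q k) powr (\<alpha> + 2)) *\<^sub>R (q j - q k))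
      = (\<Sum>j\<in>{1..n}. (m j / ?r j powr (\<alpha> + 2)) *\<^sub>R (cis (\<theta> j) - cis (\<theta> k)))"
    using assms by (intro sum.mono_neutral_cong_left) (auto simp: cmod_cis_diff)
  ultimately have "((\<Sum>j\<in>{1..n}. (m j / ?r j powr (\<alpha> + 2)) *\<^sub>R (cis (\<theta> j) - cis (\<theta> k)))
      + (l / \<alpha>) *\<^sub>R cis (\<theta> k)) * cis (- \<theta> k) = 0"
    using assms by simp
  then have *: "(\<Sum>j\<in>{1..n}. (m j / ?r j powr (\<alpha> + 2)) *\<^sub>R (cis (\<theta> j - \<theta> k) - 1)) + of_real (l / \<alpha>) = 0"
    by (simp add: distrib_right sum_distrib_right left_diff_distrib cis_mult scaleR_conv_of_real mult.assoc)
  have "(\<Sum>j\<in>{1..n}. m j * circle_force \<alpha> (\<theta> j - \<theta> k))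
      = Im ((\<Sum>j\<in>{1..n}. (m j / ?r j powr (\<alpha> + 2)) *\<^sub>R (cis (\<theta> j - \<theta> k) - 1)) + of_real (l / \<alpha>))"
    by (simp add: circle_force_def)
  then show "(\<Sum>j\<in>{1..n}. m j * circle_force \<alpha> (\<theta> j - \<theta> k)) = 0"
    unfolding * by simp
  \<comment> \<open>The identity cos t - 1 = - r^2 / 2, with r the chord length, lowers the exponent
    \<open>\<alpha> + 2\<close> to \<open>\<alpha>\<close>. For r = 0 both sides are 0 by the
    conventions for \<open>powr\<close> and division.\<close>
  have summand: "m j * circle_pot \<alpha> (\<theta> j - \<theta> k) = - 2 * (m j / ?r j powr (\<alpha> + 2) * (cos (\<theta> j - \<theta> k) - 1))" for j
  proof (cases "?r j = 0")
    case False
    have cos: "cos (\<theta> j - \<theta> k) - 1 = - (?r j)\<^sup>2 / 2"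
      by (simp add: cos_sin_half[of "\<theta> j - \<theta> k"] power_mult_distrib)
    have "(?r j)\<^sup>2 = ?r j powr 2" using False by (subst powr_numeral) auto
    then have "circle_pot \<alpha> (\<theta> j - \<theta> k) = (?r j)\<^sup>2 / ?r j powr (\<alpha> + 2)"
      using False by (simp add: circle_pot_def powr_add powr_minus field_simps)
    then show ?thesis unfolding cos by simp
  qed (simp add: circle_pot_def)
  have "Re ((\<Sum>j\<in>{1..n}. (m j / ?r j powr (\<alpha> + 2)) *\<^sub>R (cis (\<theta> j - \<theta> k) - 1)) + of_real (l / \<alpha>)) = 0"
    unfolding * by simp
  then have "(\<Sum>j\<in>{1..n}. m j / ?r j powr (\<alpha> + 2) * (cos (\<theta> j - \<theta> k) - 1)) = - (l / \<alpha>)"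
    by simp
  then show "(\<Sum>j\<in>{1..n}. m j * circle_pot \<alpha> (\<theta> j - \<theta> k)) = 2 * l / \<alpha>"
    unfolding summand sum_distrib_left[symmetric] by simp
qed

section \<open>Critical angles minimize the energy in their cyclic order\<close>

text \<open>Adding up the tangent inequalities, the linear terms cancel because \<open>\<theta>\<close> is critical.\<close>

lemma circle_energy_min:
  fixes m :: "nat \<Rightarrow> real"
  assumes "\<alpha> > 0" "\<And>i. i \<in> I \<Longrightarrow> m i > 0"
    and crit: "\<And>k. k \<in> I \<Longrightarrow> (\<Sum>j\<in>I. m j * circle_force \<alpha> (\<theta> j - \<theta> k)) = 0"
    and \<theta>: "\<And>i j. i \<in> I \<Longrightarrow> j \<in> I \<Longrightarrow> i < j \<Longrightarrow> \<theta> j - \<theta> i \<in> {0<..<2*pi}"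
    and \<phi>: "\<And>i j. i \<in> I \<Longrightarrow> j \<in> I \<Longrightarrow> i < j \<Longrightarrow> \<phi> j - \<phi> i \<in> {0<..<2*pi}"
  shows "(\<Sum>i\<in>I. \<Sum>j\<in>I. m i * m j * circle_pot \<alpha> (\<theta> i - \<theta> j))
       \<le> (\<Sum>i\<in>I. \<Sum>j\<in>I. m i * m j * circle_pot \<alpha> (\<phi> i - \<phi> j))"
proof -
  let ?g = "circle_pot \<alpha>" and ?F = "circle_force \<alpha>"
  define \<epsilon> where "\<epsilon> i = \<phi> i - \<theta> i" for i
  have tangent: "?g (\<theta> i - \<theta> j) - \<alpha> * ?F (\<theta> i - \<theta> j) * (\<epsilon> i - \<epsilon> j) \<le> ?g (\<phi> i - \<phi> j)"
    if "i \<in> I" "j \<in> I" for i j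
  \<comment> \<open>Convexity is available only for differences in (0, 2 pi), so for
    \<open>i < j\<close> the pair is reversed: the potential is even and the force odd.\<close>
  proof (cases i j rule: linorder_cases)
    case less
    then have "?g (\<theta> j - \<theta> i) - \<alpha> * ?F (\<theta> j - \<theta> i) * (\<phi> j - \<phi> i - (\<theta> j - \<theta> i)) \<le> ?g (\<phi> j - \<phi> i)"
      using that assms by (intro circle_pot_above_tangent) auto
    moreover have "?F (\<theta> i - \<theta> j) = - ?F (\<theta> j - \<theta> i)"
      using circle_force_minus[of \<alpha> "\<theta> j - \<theta> i"] by simp
    ultimately show ?thesis
      using circle_pot_commute[of \<alpha> "\<theta> i" "\<theta> j"] circle_pot_commute[of \<alpha> "\<phi> i" "\<phi> j"]
      by (simp add: \<epsilon>_def algebra_simps)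
  next
    case greater
    then have "?g (\<theta> i - \<theta> j) - \<alpha> * ?F (\<theta> i - \<theta> j) * (\<phi> i - \<phi> j - (\<theta> i - \<theta> j)) \<le> ?g (\<phi> i - \<phi> j)"
      using that assms by (intro circle_pot_above_tangent) auto
    then show ?thesis by (simp add: \<epsilon>_def algebra_simps)
  qed simp
  have crit': "(\<Sum>j\<in>I. m j * ?F (\<theta> k - \<theta> j)) = 0" if "k \<in> I" for k
  proof -
    have "(\<Sum>j\<in>I. m j * ?F (\<theta> k - \<theta> j)) = (\<Sum>j\<in>I. - (m j * ?F (\<theta> j - \<theta> k)))"
      by (intro sum.cong refl) (metis circle_force_minus minus_diff_eq mult_minus_right)
    then show ?thesis using crit[OF that] by (simp add: sum_negf)
  qed
  have "(\<Sum>i\<in>I. \<Sum>j\<in>I. m i * m j * ?F (\<theta> i - \<theta> j) * \<epsilon> i) =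
      (\<Sum>i\<in>I. m i * \<epsilon> i * (\<Sum>j\<in>I. m j * ?F (\<theta> i - \<theta> j)))"
    by (simp add: sum_distrib_left mult_ac)
  also have "\<dots> = 0" using crit' by simp
  finally have 1: "(\<Sum>i\<in>I. \<Sum>j\<in>I. m i * m j * ?F (\<theta> i - \<theta> j) * \<epsilon> i) = 0" .
  have "(\<Sum>i\<in>I. \<Sum>j\<in>I. m i * m j * ?F (\<theta> i - \<theta> j) * \<epsilon> j) =
      (\<Sum>j\<in>I. m j * \<epsilon> j * (\<Sum>i\<in>I. m i * ?F (\<theta> i - \<theta> j)))"
    by (subst sum.swap) (simp add: sum_distrib_left mult_ac)
  also have "\<dots> = 0" using crit by simp
  finally have 2: "(\<Sum>i\<in>I. \<Sum>j\<in>I. m i * m j * ?F (\<theta> i - \<theta> j) * \<epsilon> j) = 0" .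
  have "(\<Sum>i\<in>I. \<Sum>j\<in>I. m i * m j * ?g (\<theta> i - \<theta> j)) =
     (\<Sum>i\<in>I. \<Sum>j\<in>I. m i * m j * ?g (\<theta> i - \<theta> j))
       - \<alpha> * ((\<Sum>i\<in>I. \<Sum>j\<in>I. m i * m j * ?F (\<theta> i - \<theta> j) * \<epsilon> i)
            - (\<Sum>i\<in>I. \<Sum>j\<in>I. m i * m j * ?F (\<theta> i - \<theta> j) * \<epsilon> j))"
    unfolding 1 2 by simp
  also have "\<dots> = (\<Sum>i\<in>I. \<Sum>j\<in>I. m i * m j * (?g (\<theta> i - \<theta> j) - \<alpha> * ?F (\<theta> i - \<theta> j) * (\<epsilon> i - \<epsilon> j)))"
    by (simp add: sum_subtractf[symmetric] sum_distrib_left algebra_simps)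
  also have "\<dots> \<le> (\<Sum>i\<in>I. \<Sum>j\<in>I. m i * m j * ?g (\<phi> i - \<phi> j))"
    using tangent assms(2) by (intro sum_mono mult_left_mono) (auto simp: less_imp_le)
  finally show ?thesis .
qed

section \<open>Reflections of the cyclic order\<close>

text \<open>The reflection \<open>i \<mapsto> s - i\<close> modulo \<open>n\<close>, with residues taken in \<open>{1..n}\<close>.\<close>

definition cyc_refl :: "nat \<Rightarrow> nat \<Rightarrow> nat \<Rightarrow> nat" where
  "cyc_refl n s i = (if i < s then s - i else s + n - i)"

lemma cyc_refl_in: "s \<in> {1..n} \<Longrightarrow> i \<in> {1..n} \<Longrightarrow> cyc_refl n s i \<in> {1..n}"
  by (auto simp: cyc_refl_def)

lemma cyc_refl_cyc_refl: "s \<in> {1..n} \<Longrightarrow> i \<in> {1..n} \<Longrightarrow> cyc_refl n s (cyc_refl n s i) = i"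
  by (auto simp: cyc_refl_def)

lemma bij_betw_cyc_refl: "s \<in> {1..n} \<Longrightarrow> bij_betw (cyc_refl n s) {1..n} {1..n}"
  by (rule bij_betw_byWitness[where f' = "cyc_refl n s"])
    (use cyc_refl_in cyc_refl_cyc_refl in blast)+

text \<open>Reflecting the circle preserves the energy of the positions, so the minimality of the
  configuration gives \<open>m'\<^sup>T W m' \<ge> m\<^sup>T W m\<close> for the reflected masses \<open>m'\<close>; the linear term in
  \<open>m' - m\<close> drops out because \<open>W m\<close> is constant.\<close>

lemma reflection_form_nonneg:
  fixes m :: "nat \<Rightarrow> real"
  assumes "\<alpha> > 0" "\<And>i. i \<in> {1..n} \<Longrightarrow> m i > 0"
    and \<theta>: "strict_mono_on {1..n} \<theta>" "0 < \<theta> 1" "\<theta> n \<le> 2 * pi"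
    and pot: "\<And>k. k \<in> {1..n} \<Longrightarrow> (\<Sum>j\<in>{1..n}. m j * circle_pot \<alpha> (\<theta> j - \<theta> k)) = c"
    and crit: "\<And>k. k \<in> {1..n} \<Longrightarrow> (\<Sum>j\<in>{1..n}. m j * circle_force \<alpha> (\<theta> j - \<theta> k)) = 0"
    and s: "s \<in> {1..n}"
  defines "\<delta> \<equiv> \<lambda>i. m (cyc_refl n s i) - m i"
  shows "(\<Sum>i\<in>{1..n}. \<Sum>j\<in>{1..n}. \<delta> i * \<delta> j * circle_pot \<alpha> (\<theta> i - \<theta> j)) \<ge> 0"
proof -
  let ?I = "{1..n}" and ?\<sigma> = "cyc_refl n s" and ?g = "circle_pot \<alpha>"
  note bij = bij_betw_cyc_refl[OF s]
  \<comment> \<open>The mirror image of the configuration, relabelled by \<open>?\<sigma>\<close>.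
    Adding \<open>2 * pi\<close> from index \<open>s\<close> on makes the angles increasing, with
    total spread below \<open>2 * pi\<close>.\<close>
  define \<phi> where "\<phi> i = (if i < s then - \<theta> (?\<sigma> i) else 2 * pi - \<theta> (?\<sigma> i))" for i
  have mono: "\<theta> i < \<theta> j" if "i \<in> ?I" "j \<in> ?I" "i < j" for i j
    using \<theta>(1) that by (auto simp: strict_mono_on_def)
  have pos: "0 < \<theta> i" "\<theta> i \<le> 2 * pi" if "i \<in> ?I" for i
  proof -
    show "0 < \<theta> i" using mono[of 1 i] that \<theta>(2) by (cases "i = 1") auto
    show "\<theta> i \<le> 2 * pi" using mono[of i n] that \<theta>(3) by (cases "i = n") auto
  qed
  have \<theta>_range: "\<theta> j - \<theta> i \<in> {0<..<2*pi}" if "i \<in> ?I" "j \<in> ?I" "i < j" for i j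
    using mono[OF that] pos[OF that(1)] pos[OF that(2)] by simp
  have \<phi>_range: "\<phi> j - \<phi> i \<in> {0<..<2*pi}" if ij: "i \<in> ?I" "j \<in> ?I" "i < j" for i j
  proof -
    have \<sigma>: "?\<sigma> i \<in> ?I" "?\<sigma> j \<in> ?I" using cyc_refl_in[OF s] ij by auto
    show ?thesis
    proof (cases "i < s \<and> s \<le> j")
      case True
      then have "?\<sigma> i < ?\<sigma> j" using ij s by (auto simp: cyc_refl_def)
      then show ?thesis using True mono[of "?\<sigma> i" "?\<sigma> j"] \<sigma> pos[OF \<sigma>(1)] pos[OF \<sigma>(2)]
        by (simp add: \<phi>_def)
    next
      case False
      then have "?\<sigma> j < ?\<sigma> i" using ij s by (auto simp: cyc_refl_def)
      then show ?thesis using False ij mono[of "?\<sigma> j" "?\<sigma> i"] \<sigma> pos[OF \<sigma>(1)] pos[OF \<sigma>(2)]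
        by (auto simp: \<phi>_def)
    qed
  qed
  have \<phi>_pot: "?g (\<phi> i - \<phi> j) = ?g (\<theta> (?\<sigma> i) - \<theta> (?\<sigma> j))" for i j
    using circle_pot_shift[of \<alpha> "\<theta> (?\<sigma> i) - \<theta> (?\<sigma> j)"] circle_pot_shift[of \<alpha> "\<theta> (?\<sigma> j) - \<theta> (?\<sigma> i)"]
      circle_pot_commute[of \<alpha> "\<theta> (?\<sigma> i)" "\<theta> (?\<sigma> j)"]
      circle_pot_minus[of \<alpha> "2 * pi - (\<theta> (?\<sigma> j) - \<theta> (?\<sigma> i))"]
    by (auto simp: \<phi>_def algebra_simps)
  define m' where "m' i = m (?\<sigma> i)" for i
  have "(\<Sum>i\<in>?I. \<Sum>j\<in>?I. m i * m j * ?g (\<theta> i - \<theta> j))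
      \<le> (\<Sum>i\<in>?I. \<Sum>j\<in>?I. m i * m j * ?g (\<phi> i - \<phi> j))"
    by (rule circle_energy_min) (use assms(1,2) crit \<theta>_range \<phi>_range in auto)
  \<comment> \<open>As \<open>?\<sigma>\<close> is an involution, reindexing both sums moves the
    reflection from the angles to the masses.\<close>
  also have "\<dots> = (\<Sum>i\<in>?I. \<Sum>j\<in>?I. m' (?\<sigma> i) * m' (?\<sigma> j) * ?g (\<theta> (?\<sigma> i) - \<theta> (?\<sigma> j)))"
    unfolding \<phi>_pot m'_def by (intro sum.cong refl) (simp add: cyc_refl_cyc_refl[OF s])
  also have "\<dots> = (\<Sum>i\<in>?I. \<Sum>j\<in>?I. m' (?\<sigma> i) * m' j * ?g (\<theta> (?\<sigma> i) - \<theta> j))"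
    by (intro sum.cong refl sum.reindex_bij_betw[OF bij])
  also have "\<dots> = (\<Sum>i\<in>?I. \<Sum>j\<in>?I. m' i * m' j * ?g (\<theta> i - \<theta> j))"
    by (rule sum.reindex_bij_betw[OF bij])
  finally have ineq: "(\<Sum>i\<in>?I. \<Sum>j\<in>?I. m i * m j * ?g (\<theta> i - \<theta> j))
      \<le> (\<Sum>i\<in>?I. \<Sum>j\<in>?I. m' i * m' j * ?g (\<theta> i - \<theta> j))" .
  \<comment> \<open>A permutation preserves the total mass, so \<open>\<delta>\<close> is orthogonal
    to constant vectors.\<close>
  have \<delta>0: "(\<Sum>i\<in>?I. \<delta> i) = 0"
    unfolding \<delta>_def sum_subtractf using sum.reindex_bij_betw[OF bij, of m] by simp
  have "(\<Sum>i\<in>?I. \<Sum>j\<in>?I. m i * \<delta> j * ?g (\<theta> i - \<theta> j))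
      = (\<Sum>j\<in>?I. \<delta> j * (\<Sum>i\<in>?I. m i * ?g (\<theta> i - \<theta> j)))"
    by (subst sum.swap) (simp add: sum_distrib_left mult_ac)
  also have "\<dots> = 0" using \<delta>0 pot by (simp add: sum_distrib_right[symmetric])
  finally have cross1: "(\<Sum>i\<in>?I. \<Sum>j\<in>?I. m i * \<delta> j * ?g (\<theta> i - \<theta> j)) = 0" .
  have cross2: "(\<Sum>i\<in>?I. \<Sum>j\<in>?I. \<delta> i * m j * ?g (\<theta> i - \<theta> j)) = 0"
    using cross1 by (subst sum.swap) (simp add: mult_ac circle_pot_commute[of \<alpha> "\<theta> _" "\<theta> _"])
  have "(\<Sum>i\<in>?I. \<Sum>j\<in>?I. m' i * m' j * ?g (\<theta> i - \<theta> j)) =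
      (\<Sum>i\<in>?I. \<Sum>j\<in>?I. m i * m j * ?g (\<theta> i - \<theta> j))
    + (\<Sum>i\<in>?I. \<Sum>j\<in>?I. m i * \<delta> j * ?g (\<theta> i - \<theta> j))
    + (\<Sum>i\<in>?I. \<Sum>j\<in>?I. \<delta> i * m j * ?g (\<theta> i - \<theta> j))
    + (\<Sum>i\<in>?I. \<Sum>j\<in>?I. \<delta> i * \<delta> j * ?g (\<theta> i - \<theta> j))"
    unfolding sum.distrib[symmetric] m'_def \<delta>_def
    by (intro sum.cong refl) (simp add: algebra_simps)
  then show ?thesis using ineq cross1 cross2 by simp
qed

section \<open>Two exceptional masses: mass differences supported on two or four bodies\<close>

lemma sum_sum_support:
  fixes \<delta> :: "'a \<Rightarrow> real"
  assumes "finite I" "S \<subseteq> I" "\<And>i. i \<in> I - S \<Longrightarrow> \<delta> i = 0"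
  shows "(\<Sum>i\<in>I. \<Sum>j\<in>I. \<delta> i * \<delta> j * w i j) = (\<Sum>i\<in>S. \<Sum>j\<in>S. \<delta> i * \<delta> j * w i j)"
proof -
  have "(\<Sum>j\<in>I. \<delta> i * \<delta> j * w i j) = (\<Sum>j\<in>S. \<delta> i * \<delta> j * w i j)" for i
    using assms by (intro sum.mono_neutral_right) auto
  then have "(\<Sum>i\<in>I. \<Sum>j\<in>I. \<delta> i * \<delta> j * w i j) = (\<Sum>i\<in>I. \<Sum>j\<in>S. \<delta> i * \<delta> j * w i j)"
    by simp
  also have "\<dots> = (\<Sum>i\<in>S. \<Sum>j\<in>S. \<delta> i * \<delta> j * w i j)"
    using assms by (intro sum.mono_neutral_right) auto
  finally show ?thesis .
qed

theorem theorem1: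
  fixes \<alpha> \<mu> :: real and n j k :: nat and m :: "nat \<Rightarrow> real"
  assumes "\<alpha> > 0" and "n \<ge> 3"
    and "\<And>i. i \<in> {1..n} \<Longrightarrow> m i > 0"
    and "\<mu> > 0"
    and "j \<in> {1..n}" and "k \<in> {1..n}" and "j \<noteq> k"
    and "\<And>i. i \<in> {1..n} - {j, k} \<Longrightarrow> m i = \<mu>"
    and "m j \<noteq> \<mu>" and "m k \<noteq> \<mu>"
  shows "\<not> (\<exists>q :: nat \<Rightarrow> complex. centered_cocircular_cc \<alpha> n m q)"
proof
  assume "\<exists>q :: nat \<Rightarrow> complex. centered_cocircular_cc \<alpha> n m q"
  then obtain q \<theta> l where \<theta>: "strict_mono_on {1..n} \<theta>" "0 < \<theta> 1" "\<theta> n \<le> 2 * pi"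
    and q: "\<forall>j\<in>{1..n}. q j = cis (\<theta> j)" and cc: "central_eqs \<alpha> n m q l"
    unfolding centered_cocircular_cc_def by blast
  let ?I = "{1..n}"
  define w where "w a b = circle_pot \<alpha> (\<theta> a - \<theta> b)" for a b
  have w_commute: "w a b = w b a" for a b unfolding w_def by (rule circle_pot_commute)
  have w_refl [simp]: "w a a = 0" for a by (simp add: w_def)
  have mono: "\<theta> a < \<theta> b" if "a \<in> ?I" "b \<in> ?I" "a < b" for a b
    using \<theta>(1) that by (auto simp: strict_mono_on_def)
  have spread: "\<theta> b < \<theta> a + 2 * pi" if "a \<in> ?I" "b \<in> ?I" for a b
  proof -
    have "0 < \<theta> a" using mono[of 1 a] that \<theta>(2) by (cases "a = 1") auto
    moreover have "\<theta> b \<le> 2 * pi" using mono[of b n] that \<theta>(3) by (cases "b = n") auto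
    ultimately show ?thesis by simp
  qed
  have w_pos: "w a b > 0" if "a \<in> ?I" "b \<in> ?I" "a \<noteq> b" for a b
    using that
  proof (induction a b rule: linorder_wlog)
    case (le a b)
    then have "circle_pot \<alpha> (\<theta> b - \<theta> a) > 0"
      using mono[of a b] spread[of a b] by (intro circle_pot_pos) auto
    then show ?case using w_commute by (simp add: w_def)
  qed (simp add: w_commute)
  have form: "(\<Sum>a\<in>S. \<Sum>b\<in>S. (m (cyc_refl n s a) - m a) * (m (cyc_refl n s b) - m b) * w a b) \<ge> 0"
    if "s \<in> ?I" "S \<subseteq> ?I" "\<And>i. i \<in> ?I - S \<Longrightarrow> m (cyc_refl n s i) = m i" for s S
  proof -
    have "(\<Sum>a\<in>?I. \<Sum>b\<in>?I. (m (cyc_refl n s a) - m a) * (m (cyc_refl n s b) - m b) * w a b) \<ge> 0"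
      unfolding w_def
      by (rule reflection_form_nonneg[OF assms(1,3) \<theta> central_eqs_cis[OF cc q] that(1)])
    then show ?thesis
      using that by (subst (asm) sum_sum_support[where S = S]) auto
  qed
  \<comment> \<open>With d the mass difference between \<open>a\<close> and its image, the form
    would be - 2 d^2 times a positive potential.\<close>
  have no_swap: "m (cyc_refl n s a) = m a"
    if s: "s \<in> ?I" and a: "a \<in> ?I"
      and fx: "\<And>i. i \<in> ?I - {a, cyc_refl n s a} \<Longrightarrow> m (cyc_refl n s i) = m i" for s a
  proof (rule ccontr)
    let ?b = "cyc_refl n s a"
    assume ne: "m ?b \<noteq> m a"
    then have ab: "a \<noteq> ?b" by metis
    have b: "?b \<in> ?I" "cyc_refl n s ?b = a" using cyc_refl_in[OF s a] cyc_refl_cyc_refl[OF s a] by auto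
    have "0 \<le> (\<Sum>c\<in>{a, ?b}. \<Sum>d\<in>{a, ?b}. (m (cyc_refl n s c) - m c) * (m (cyc_refl n s d) - m d) * w c d)"
      by (rule form[OF s]) (use a b fx in auto)
    then have "0 \<le> - 2 * (m ?b - m a)\<^sup>2 * w a ?b"
      using b ab w_commute[of a ?b] by (simp add: power2_eq_square algebra_simps)
    moreover have "(m ?b - m a)\<^sup>2 * w a ?b > 0"
      using ne w_pos[OF a b(1) ab] by simp
    ultimately show False by linarith
  qed
  \<comment> \<open>The residue of \<open>2 * j\<close> modulo \<open>n\<close>, so that the
    reflection fixes \<open>j\<close>.\<close>
  define s where "s = (if 2 * j \<le> n then 2 * j else 2 * j - n)"
  have s: "s \<in> ?I" using assms(5) by (auto simp: s_def)
  have sj: "cyc_refl n s j = j" using assms(5) by (auto simp: s_def cyc_refl_def)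
  \<comment> \<open>If \<open>k\<close> moved, its image would have mass \<open>\<mu>\<close>, and
    masses would change only at these two bodies, against \<open>no_swap\<close>.\<close>
  have opp: "cyc_refl n s k = k"
  proof (rule ccontr)
    assume k': "cyc_refl n s k \<noteq> k"
    have k'j: "cyc_refl n s k \<noteq> j"
      using cyc_refl_cyc_refl[OF s assms(6)] sj assms(7) by metis
    have "m (cyc_refl n s k) = m k"
    proof (rule no_swap[OF s assms(6)])
      fix i assume i: "i \<in> ?I - {k, cyc_refl n s k}"
      show "m (cyc_refl n s i) = m i"
      proof (cases "i = j")
        case False
        have "cyc_refl n s i \<noteq> j" "cyc_refl n s i \<noteq> k"
          using cyc_refl_cyc_refl[OF s, of i] i sj False by (metis DiffD1, metis DiffD1 DiffD2 insertCI)
        then show ?thesis using cyc_refl_in[OF s, of i] i False assms(8) by simp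
      qed (simp add: sj)
    qed
    moreover have "m (cyc_refl n s k) = \<mu>"
      using assms(8) cyc_refl_in[OF s assms(6)] k' k'j by simp
    ultimately show False using assms(10) by simp
  qed
  have half: "2 * k = 2 * j + n \<or> 2 * j = 2 * k + n"
    using opp assms(5-7) by (auto simp: cyc_refl_def s_def split: if_splits)
  have eq: "m j = m k"
  proof -
    \<comment> \<open>The residue of \<open>j + k\<close>: this reflection exchanges
      \<open>j\<close> and \<open>k\<close>.\<close>
    define t where "t = (if j + k \<le> n then j + k else j + k - n)"
    have t: "t \<in> ?I" using assms(5,6) by (auto simp: t_def)
    have tj: "cyc_refl n t j = k" and tk: "cyc_refl n t k = j"
      using assms(5,6) by (auto simp: t_def cyc_refl_def)
    have "m (cyc_refl n t j) = m j"
    proof (rule no_swap[OF t assms(5)])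
      fix i assume i: "i \<in> ?I - {j, cyc_refl n t j}"
      have "cyc_refl n t i \<noteq> j" "cyc_refl n t i \<noteq> k"
        using cyc_refl_cyc_refl[OF t, of i] i tj tk by auto
      then show "m (cyc_refl n t i) = m i"
        using cyc_refl_in[OF t, of i] i tj assms(8) by simp
    qed
    then show ?thesis using tj by simp
  qed
  have final: False if a: "a \<in> ?I" and b: "b \<in> ?I" and ab: "2 * b = 2 * a + n"
    and ma: "m a \<noteq> \<mu>" "m b = m a" and mi: "\<And>i. i \<in> ?I - {a, b} \<Longrightarrow> m i = \<mu>" for a b
  proof -
    \<comment> \<open>Modulo \<open>n\<close>, \<open>2 * a + 1 - b\<close> is \<open>b + 1\<close>,
      so both \<open>a\<close> and \<open>b\<close> are exchanged with their successors. Only the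
      successor of \<open>b\<close> can wrap around, since \<open>a < b\<close>.\<close>
    define t where "t = (if 2 * a + 1 \<le> n then 2 * a + 1 else 2 * a + 1 - n)"
    define b' where "b' = (if b = n then 1 else b + 1)"
    let ?a' = "a + 1"
    have t: "t \<in> ?I" using a b ab by (auto simp: t_def)
    have t_vals: "cyc_refl n t a = ?a'" "cyc_refl n t ?a' = a" "cyc_refl n t b = b'" "cyc_refl n t b' = b"
      using a b ab assms(2) by (auto simp: t_def cyc_refl_def b'_def)
    \<comment> \<open>Here \<open>n\<close> is even and at least 3, so \<open>b - a\<close> is at
      least 2.\<close>
    have dist: "a \<noteq> b" "a \<noteq> b'" "?a' \<noteq> b" "?a' \<noteq> b'" "b \<noteq> b'" and mem: "?a' \<in> ?I" "b' \<in> ?I"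
      using a b ab assms(2) by (auto simp: b'_def)
    have "m ?a' = \<mu>" "m b' = \<mu>" using mi[of ?a'] mi[of b'] dist mem by auto
    have fx: "m (cyc_refl n t i) = m i" if i: "i \<in> ?I - {a, ?a', b, b'}" for i
    proof -
      have "cyc_refl n t i \<noteq> a" "cyc_refl n t i \<noteq> b"
        using cyc_refl_cyc_refl[OF t, of i] i t_vals by auto
      then show ?thesis using cyc_refl_in[OF t, of i] i mi by simp
    qed
    have "0 \<le> (\<Sum>c\<in>{a, ?a', b, b'}. \<Sum>d\<in>{a, ?a', b, b'}.
        (m (cyc_refl n t c) - m c) * (m (cyc_refl n t d) - m d) * w c d)"
      by (rule form[OF t]) (use a b mem fx in auto)
    \<comment> \<open>The mass change is \<open>\<mu> - m a\<close> at \<open>a\<close> and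
      \<open>b\<close>, and its negative at their successors. Equal signs occur on the diagonals of
      the quadrilateral, opposite signs on its sides.\<close>
    then have "0 \<le> 2 * (m a - \<mu>)\<^sup>2 * (w a b + w ?a' b' - w a ?a' - w a b' - w b ?a' - w b b')"
      using dist t_vals \<open>m ?a' = \<mu>\<close> \<open>m b' = \<mu>\<close> ma(2)
        w_commute[of ?a' a] w_commute[of b a] w_commute[of b' a] w_commute[of b ?a']
        w_commute[of b' ?a'] w_commute[of b' b]
      by (simp add: power2_eq_square algebra_simps)
    moreover have "(m a - \<mu>)\<^sup>2 > 0" using ma by simp
    ultimately have "w a b + w ?a' b' - w a ?a' - w a b' - w b ?a' - w b b' \<ge> 0"
      by (simp add: zero_le_mult_iff)
    moreover have quad: "w p x + w o' y < w p o' + w o' x + w x y + w p y"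
      if "p \<in> ?I" "o' \<in> ?I" "x \<in> ?I" "y \<in> ?I" "p < o'" "o' < x" "x < y" for p o' x y
      using circle_pot_diagonals_less_sides[OF assms(1) mono[of p o'] mono[of o' x] mono[of x y] spread[of p y]] that
        w_commute by (simp add: w_def)
    have "w a b + w ?a' b' < w a ?a' + w a b' + w b ?a' + w b b'"
    \<comment> \<open>For \<open>b = n\<close> the successor \<open>b'\<close> is 1, and the
      increasing order starts with it.\<close>
    proof (cases "b = n")
      case True
      then have "b' < a" "?a' < b" using a ab assms(2) dist by (auto simp: b'_def)
      then show ?thesis using quad[of b' a ?a' b] a b mem w_commute by simp
    next
      case False
      then have "?a' < b" "b < b'" using a ab assms(2) dist by (auto simp: b'_def)
      then show ?thesis using quad[of a ?a' b b'] a b mem w_commute by simp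
    qed
    ultimately show False by simp
  qed
  show False
    using half
  proof
    assume "2 * k = 2 * j + n"
    then show False by (rule final[OF assms(5,6) _ assms(9) eq[symmetric] assms(8)])
  next
    assume "2 * j = 2 * k + n"
    moreover have "m i = \<mu>" if "i \<in> ?I - {k, j}" for i
      using assms(8) that by blast
    ultimately show False by (rule final[OF assms(6,5) _ assms(10) eq])
  qed
qed

end
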